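(* Let $r,\ell\ge1$ and $N=2(\ell+r+2)$. Let $T_{i,j,k}$ be the solution of the $\ell$-restricted $A_r$ $T$-system: $i\in[0,r+1]$, $j\in[0,\ell+1]$, $k\in\mathbb{Z}$, $i+j+k$ even, $$T_{i,j,k+1}T_{i,j,k-1}=T_{i,j+1,k}T_{i,j-1,k}+T_{i+1,j,k}T_{i-1,j,k}\qquad(i\in[1,r],\ j\in[1,\ell],\ k\in\mathbb{Z}),$$ $T_{0,j,k}=T_{r+1,j,k}=T_{i,0,k}=T_{i,\ell+1,k}=1$, with initial conditions $T_{i,j,k^{(0)}_{i,j}}=t_{i,j}$ ($i\in[1,r]$, $j\in[1,\ell]$), where $k^{(0)}_{i,j}\in\{0,1\}$ is the residue of $i+j$ mod 2 and the $t_{i,j}$ are formal variables. Then $$T_{1,j,k+\frac{N}{2}}=T_{r,\ell+1-j,k}$$ for all $k\in\mathbb{Z}$ and $j\in[1,\ell]$ such that $j+k+\ell+r$ is odd.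
   Context: The system is a three-term recursion in $k$; the initial values determine the solution uniquely as rational functions of the $t_{i,j}$. *)

theory Defs
  imports
    "HOL-Library.Poly_Mapping"
    "HOL-Library.Product_Lexorder"
    "HOL-Computational_Algebra.Polynomial_Factorial"
begin

text \<open>
  Monomials in the formal variables \<open>t\<^sub>i\<^sub>,\<^sub>j\<close> are finitely supported exponent maps
  \<open>(nat \<times> nat) \<Rightarrow>\<^sub>0 nat\<close>; polynomials are finitely supported maps from monomials to
  rational coefficients, with convolution as product.  The lexicographic order on
  \<open>nat \<times> nat\<close> serves only to make this ring an instance of \<^class>\<open>idom\<close>.
\<close>

type_synonym tpoly = "((nat \<times> nat) \<Rightarrow>\<^sub>0 nat) \<Rightarrow>\<^sub>0 rat"

type_synonym tratfun = "tpoly fract"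

definition tvar :: "nat \<Rightarrow> nat \<Rightarrow> tratfun" where
  "tvar i j = to_fract (Poly_Mapping.single (Poly_Mapping.single (i, j) 1) 1)"

text \<open>
  \<open>T i j k\<close> is meaningful only for \<open>i \<le> r + 1\<close>, \<open>j \<le> l + 1\<close> and \<open>i + j + k\<close> even; its values
  elsewhere are unconstrained.  All terms of the recursion at \<open>(i, j, k)\<close> lie in this index
  set exactly when \<open>i + j + k\<close> is odd.
\<close>

definition restricted_T_system ::
    "nat \<Rightarrow> nat \<Rightarrow> (nat \<Rightarrow> nat \<Rightarrow> int \<Rightarrow> 'a::field) \<Rightarrow> bool" where
  "restricted_T_system r l T \<longleftrightarrow>
     (\<forall>i\<in>{1..r}. \<forall>j\<in>{1..l}. \<forall>k. odd (int i + int j + k) \<longrightarrow>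
        T i j (k + 1) * T i j (k - 1) =
          T i (j + 1) k * T i (j - 1) k + T (i + 1) j k * T (i - 1) j k) \<and>
     (\<forall>j\<in>{0..l + 1}. \<forall>k. even (int j + k) \<longrightarrow> T 0 j k = 1) \<and>
     (\<forall>j\<in>{0..l + 1}. \<forall>k. even (int (r + 1) + int j + k) \<longrightarrow> T (r + 1) j k = 1) \<and>
     (\<forall>i\<in>{0..r + 1}. \<forall>k. even (int i + k) \<longrightarrow> T i 0 k = 1) \<and>
     (\<forall>i\<in>{0..r + 1}. \<forall>k. even (int i + int (l + 1) + k) \<longrightarrow> T i (l + 1) k = 1)"

definition initial_time :: "nat \<Rightarrow> nat \<Rightarrow> int" where
  "initial_time i j = int ((i + j) mod 2)"

definition has_initial_values ::
    "nat \<Rightarrow> nat \<Rightarrow> (nat \<Rightarrow> nat \<Rightarrow> 'a) \<Rightarrow> (nat \<Rightarrow> nat \<Rightarrow> int \<Rightarrow> 'a) \<Rightarrow> bool" where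
  "has_initial_values r l t T \<longleftrightarrow>
     (\<forall>i\<in>{1..r}. \<forall>j\<in>{1..l}. T i j (initial_time i j) = t i j)"

end

theory Submission
  imports Defs
begin

text \<open>
  The idea is Hirota's linear problem.  Put \<open>u i j a = T\<^sub>i\<^sub>,\<^sub>j\<close> at time \<open>2 a + i + j\<close>, extended by zero
  one step beyond both boundaries in \<open>j\<close>.  The T-system is the compatibility condition of two
  three-term linear relations for a wave function \<open>wave i j a\<close>, which is determined by its
  arbitrary values \<open>e a\<close> at \<open>i = 0\<close>.  On the boundary \<open>i = n\<close>, where \<open>u = 1\<close>, the two relations
  say that \<open>wave n j a\<close> does not depend on \<open>j\<close>.  Near the lower boundary in \<open>j\<close> its expansion in the
  \<open>e (a + s)\<close> has coefficients \<open>\<plusminus>T\<^sub>s\<^sub>,\<^sub>1\<close>, near the upper one \<open>\<plusminus>T\<^sub>n\<^sub>-\<^sub>s\<^sub>,\<^sub>l\<close> at a later time; comparing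
  them gives the half-periodicity along \<open>j = 1\<close>.  The theorem is this statement after exchanging
  \<open>i\<close> with \<open>j\<close> and reversing time.  Divisions are legitimate because the \<open>T\<^sub>i\<^sub>,\<^sub>j\<^sub>,\<^sub>k\<close> are
  subtraction-free, hence nonzero, rational functions.
\<close>

section \<open>The linear problem and its half-periodicity\<close>

text \<open>The index \<open>j\<close> is shifted by one: \<open>j = 1\<close> and \<open>j = m + 1\<close> are the boundaries where \<open>u = 1\<close>.\<close>

locale padded_T_system =
  fixes n m :: nat and u :: "nat \<Rightarrow> nat \<Rightarrow> int \<Rightarrow> 'a::field"
  assumes n_pos: "1 \<le> n" and m_pos: "1 \<le> m"
    and hirota: "\<lbrakk>1 \<le> i; i < n; 1 \<le> j; j \<le> m + 1\<rbrakk> \<Longrightarrow>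
      u i j a * u i j (a + 1) = u i (j - 1) (a + 1) * u i (j + 1) a + u (i + 1) j a * u (i - 1) j (a + 1)"
    and nonzero: "\<lbrakk>i \<le> n; 1 \<le> j; j \<le> m + 1\<rbrakk> \<Longrightarrow> u i j a \<noteq> 0"
    and first: "\<lbrakk>1 \<le> j; j \<le> m + 1\<rbrakk> \<Longrightarrow> u 0 j a = 1"
    and last: "\<lbrakk>1 \<le> j; j \<le> m + 1\<rbrakk> \<Longrightarrow> u n j a = 1"
    and bottom: "i \<le> n \<Longrightarrow> u i 1 a = 1"
    and top: "i \<le> n \<Longrightarrow> u i (m + 1) a = 1"
    and below: "i \<le> n \<Longrightarrow> u i 0 a = 0"
    and above: "i \<le> n \<Longrightarrow> u i (m + 2) a = 0"
begin

text \<open>The quotient clause is the relation \<open>wave_up\<close> solved for its new value. The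
  clause at \<open>j = 1\<close> is the relation \<open>wave_down\<close> there, whose first term
  vanishes by \<open>below\<close>.\<close>

fun wave :: "(int \<Rightarrow> 'a) \<Rightarrow> nat \<Rightarrow> nat \<Rightarrow> int \<Rightarrow> 'a" where
  "wave e 0 j a = e a"
| "wave e (Suc i) 0 a = 0"
| "wave e (Suc i) (Suc 0) a = - wave e i (Suc 0) (a + 1)"
| "wave e (Suc i) (Suc (Suc j)) a =
     (u (Suc i) (Suc j) (a + 1) * wave e i (Suc (Suc j)) a
        - u (Suc i) (Suc (Suc j)) a * wave e i (Suc j) (a + 1)) / u i (Suc j) (a + 1)"

lemma wave_up:
  assumes "i < n" "1 \<le> j" "j \<le> m + 1"
  shows "u i j (a + 1) * wave e (Suc i) (j + 1) a =
    u (Suc i) j (a + 1) * wave e i (j + 1) a - u (Suc i) (j + 1) a * wave e i j (a + 1)"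
  using assms nonzero[of i j "a + 1"] by (cases j) auto

text \<open>This is the compatibility of the two linear relations: given both at level
  \<open>i\<close>, \<open>hirota\<close> carries the second one to level \<open>i + 1\<close>,
  where \<open>wave_up\<close> holds by construction.\<close>

lemma wave_down:
  assumes "i < n" "1 \<le> j" "j \<le> m + 1"
  shows "u i j (a + 1) * wave e (Suc i) j a =
    u (Suc i) (j - 1) (a + 1) * wave e i (j + 1) a - u (Suc i) j a * wave e i j (a + 1)"
  using assms
proof (induction i arbitrary: j a)
  case (0 j a)
  show ?case
  proof (cases "j = 1")
    case True
    with 0 show ?thesis using bottom[of 1 a] by (simp add: first below)
  next
    case False
    with 0 have "1 \<le> j - 1" "j - 1 \<le> m + 1" "j - 1 + 1 = j" by auto
    \<comment> \<open>At level 0 neither \<open>u\<close> nor \<open>wave\<close> depends on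
      \<open>j\<close>, so the claim at \<open>j\<close> is \<open>wave_up\<close> at
      \<open>j - 1\<close>.\<close>
    with 0 show ?thesis using wave_up[of 0 "j - 1" a e] by (simp add: first)
  qed
next
  case (Suc i j a)
  note IH = Suc.IH and i = Suc.prems(1)
  show ?case
  proof (cases "j = 1")
    case True
    with Suc.prems show ?thesis
      using bottom[of "Suc i" "a + 1"] bottom[of "Suc (Suc i)" a] by (simp add: below)
  next
    case False
    define h where "h = j - 1"
    have j: "j = h + 1" and h: "1 \<le> h" "h \<le> m" using Suc.prems False by (auto simp: h_def)
    let ?P = "wave e i (h + 1 + 1) a" and ?Q = "wave e i (h + 1) (a + 1)"
    let ?R = "wave e i h (a + 1 + 1)"
    let ?v = "u (Suc i)"
    let ?x = "u i (h + 1) (a + 1)" and ?y = "u i h (a + 1 + 1)"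
    have nz: "?x \<noteq> 0" "?y \<noteq> 0" "?v h (a + 1) \<noteq> 0"
      using h i by (simp_all add: nonzero)
    have d1: "?x * wave e (Suc i) (h + 1) a = ?v h (a + 1) * ?P - ?v (h + 1) a * ?Q"
      using IH[of "h + 1" a] h i by simp
    have u1: "?x * wave e (Suc i) (h + 1 + 1) a = ?v (h + 1) (a + 1) * ?P - ?v (h + 1 + 1) a * ?Q"
      using wave_up[of i "h + 1" a e] h i by simp
    have d2: "?y * wave e (Suc i) h (a + 1) = ?v (h - 1) (a + 1 + 1) * ?Q - ?v h (a + 1) * ?R"
      using IH[of h "a + 1"] h i by simp
    have u2: "?y * wave e (Suc i) (h + 1) (a + 1) = ?v h (a + 1 + 1) * ?Q - ?v (h + 1) (a + 1) * ?R"
      using wave_up[of i h "a + 1" e] h i by simp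
    have H1: "?v (h + 1) a * ?v (h + 1) (a + 1) =
        ?v h (a + 1) * ?v (h + 1 + 1) a + u (Suc (Suc i)) (h + 1) a * ?x"
      using hirota[of "Suc i" "h + 1" a] h i by simp
    have H2: "?v h (a + 1) * ?v h (a + 1 + 1) =
        ?v (h - 1) (a + 1 + 1) * ?v (h + 1) (a + 1) + u (Suc (Suc i)) h (a + 1) * ?y"
      using hirota[of "Suc i" h "a + 1"] h i by simp
    \<comment> \<open>Eliminating \<open>?P\<close> from \<open>d1\<close> and \<open>u1\<close>
      leaves a multiple of \<open>?Q\<close>, which \<open>H1\<close> simplifies; below,
      \<open>?R\<close> is eliminated from \<open>d2\<close> and \<open>u2\<close> in the same
      way.\<close>
    have "?x * (?v (h + 1) (a + 1) * wave e (Suc i) (h + 1) a - ?v h (a + 1) * wave e (Suc i) (h + 1 + 1) a)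
        = ?x * (- u (Suc (Suc i)) (h + 1) a * ?Q)"
      using d1 u1 H1 by algebra
    then have c1: "?v (h + 1) (a + 1) * wave e (Suc i) (h + 1) a
        - ?v h (a + 1) * wave e (Suc i) (h + 1 + 1) a = - u (Suc (Suc i)) (h + 1) a * ?Q"
      by (simp only: mult_left_cancel[OF nz(1)])
    have "?y * (?v (h + 1) (a + 1) * wave e (Suc i) h (a + 1) - ?v h (a + 1) * wave e (Suc i) (h + 1) (a + 1))
        = ?y * (- u (Suc (Suc i)) h (a + 1) * ?Q)"
      using d2 u2 H2 by algebra
    then have c2: "?v (h + 1) (a + 1) * wave e (Suc i) h (a + 1)
        - ?v h (a + 1) * wave e (Suc i) (h + 1) (a + 1) = - u (Suc (Suc i)) h (a + 1) * ?Q"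
      by (simp only: mult_left_cancel[OF nz(2)])
    have u3: "?v h (a + 1) * wave e (Suc (Suc i)) (h + 1) a =
        u (Suc (Suc i)) h (a + 1) * wave e (Suc i) (h + 1) a
          - u (Suc (Suc i)) (h + 1) a * wave e (Suc i) h (a + 1)"
      using wave_up[of "Suc i" h a e] h i by simp
    \<comment> \<open>Substituting \<open>c1\<close> and \<open>c2\<close> into \<open>u3\<close>
      produces two opposite multiples of \<open>?Q\<close>, which cancel.\<close>
    have "?v h (a + 1) * (?v (h + 1) (a + 1) * wave e (Suc (Suc i)) (h + 1) a) =
        ?v h (a + 1) * (u (Suc (Suc i)) h (a + 1) * wave e (Suc i) (h + 1 + 1) a
          - u (Suc (Suc i)) (h + 1) a * wave e (Suc i) (h + 1) (a + 1))"
      using u3 c1 c2 by algebra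
    then show ?thesis by (simp only: mult_left_cancel[OF nz(3)] j add_diff_cancel_right')
  qed
qed

text \<open>With all \<open>u n j a = 1\<close>, \<open>wave_up\<close> and \<open>wave_down\<close>
  have the same right-hand side. The zero padding breaks this at both ends, so the constancy spans
  positions 2 to \<open>m + 1\<close>.\<close>

lemma wave_last_const:
  assumes "1 \<le> j" "j \<le> m"
  shows "wave e n (j + 1) a = wave e n 2 a"
  using assms
proof (induction j rule: dec_induct)
  case base
  then show ?case by (simp add: numeral_2_eq_2)
next
  case (step j)
  obtain i where i: "n = Suc i" using n_pos by (cases n) auto
  have "u i (Suc j) (a + 1) * wave e n (Suc j + 1) a = u i (Suc j) (a + 1) * wave e n (Suc j) a"
    using wave_up[of i "Suc j" a e] wave_down[of i "Suc j" a e] step last[of j] last[of "Suc j"]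
      last[of "Suc (Suc j)"]
    by (simp add: i del: wave.simps)
  then show ?case using nonzero[of i "Suc j" "a + 1"] step i by simp
qed

lemma wave_bottom: "wave e i 1 a = (-1) ^ i * e (a + int i)"
  by (induction i arbitrary: a) (simp_all add: algebra_simps)

text \<open>In \<open>wave_up\<close> at \<open>j = 1\<close> the factors at position 1 are 1, so
  each step in \<open>i\<close> appends one term, supplied by \<open>wave_bottom\<close>.\<close>

lemma wave_above_bottom:
  "i \<le> n \<Longrightarrow> wave e i 2 a = (\<Sum>s\<le>i. (-1) ^ s * u s 2 a * e (a + int s))"
proof (induction i)
  case 0
  then show ?case using first[of 2] m_pos by simp
next
  case (Suc i)
  then show ?case
    using wave_up[of i 1 a e] bottom[of i] bottom[of "Suc i"] wave_bottom[of e i "a + 1"]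
    by (simp add: algebra_simps one_add_one[symmetric] del: one_add_one wave.simps)
qed

text \<open>By \<open>above\<close>, \<open>wave_up\<close> at \<open>j = m + 1\<close> loses its
  second term, so the initial values pass through unchanged.\<close>

lemma wave_above_top: "i \<le> n \<Longrightarrow> wave e i (m + 2) a = e a"
proof (induction i)
  case (Suc i)
  then show ?case using wave_up[of i "m + 1" a e] top[of i] top[of "Suc i"] above[of "Suc i"]
    by (simp del: wave.simps)
qed simp

text \<open>By \<open>wave_down\<close> at \<open>j = m + 1\<close>, each step prepends a term in
  \<open>e a\<close> and shifts the old sum by one in \<open>a\<close>; hence the index
  \<open>i - s\<close>.\<close>

lemma wave_top:
  "i \<le> n \<Longrightarrow> wave e i (m + 1) a =
     (\<Sum>s\<le>i. (-1) ^ s * u (i - s) m (a + int s + 1) * e (a + int s))"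
proof (induction i arbitrary: a)
  case 0
  then show ?case using first[of m] m_pos by simp
next
  case (Suc i)
  have "wave e (Suc i) (m + 1) a = u (Suc i) m (a + 1) * e a - wave e i (m + 1) (a + 1)"
    using wave_down[of i "m + 1" a e] top[of i] top[of "Suc i"] wave_above_top[of i e a] Suc.prems
    by (simp del: wave.simps)
  also have "\<dots> = (\<Sum>s\<le>Suc i. (-1) ^ s * u (Suc i - s) m (a + int s + 1) * e (a + int s))"
    using Suc by (simp add: sum.atMost_Suc_shift sum_negf algebra_simps
        del: wave.simps sum.atMost_Suc)
  finally show ?case .
qed

theorem half_periodicity:
  assumes "s \<le> n"
  shows "u s 2 a = u (n - s) m (a + int s + 1)"
proof -
  \<comment> \<open>This choice of initial values extracts the coefficient of
    \<open>e (a + s)\<close> from both expansions.\<close>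
  define e where "e x = (if x = a + int s then 1 else 0 :: 'a)" for x
  have "wave e n (m + 1) a = wave e n 2 a" using wave_last_const[of m] m_pos by simp
  then have "(\<Sum>t\<le>n. (-1) ^ t * u (n - t) m (a + int t + 1) * e (a + int t))
      = (\<Sum>t\<le>n. (-1) ^ t * u t 2 a * e (a + int t))"
    by (simp only: wave_top wave_above_bottom order.refl)
  then show ?thesis using assms by (simp add: e_def if_distrib sum.delta' cong: if_cong)
qed

end

section \<open>Transfer to the restricted T-system\<close>

lemma restricted_T_system_half_periodicity:
  fixes T :: "nat \<Rightarrow> nat \<Rightarrow> int \<Rightarrow> 'a::field"
  assumes T: "restricted_T_system r l T" and "1 \<le> r"
    and nonzero: "\<And>i j k. \<lbrakk>i \<le> r + 1; j \<le> l + 1; even (int i + int j + k)\<rbrakk> \<Longrightarrow> T i j k \<noteq> 0"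
    and j: "j \<le> l + 1" and par: "even (int j + k + int l + int r + 1)"
  shows "T 1 j (k + int (l + r + 2)) = T r (l + 1 - j) k"
proof -
  \<comment> \<open>The first argument is the column of \<open>T\<close>, the second its row plus
    one. The time \<open>-(2 * a + i + h)\<close> has the parity of \<open>i + h\<close>, so only
    constrained entries of \<open>T\<close> occur.\<close>
  define u where "u i j a = (case j of 0 \<Rightarrow> 0
    | Suc h \<Rightarrow> if h \<le> r + 1 then T h i (- (2 * a + int i + int h)) else 0)" for i j a
  have u_Suc: "u i (Suc h) a = T h i (- (2 * a + int i + int h))" if "h \<le> r + 1" for i h a
    using that by (simp add: u_def)
  have u_outside: "u i 0 a = 0" "u i (Suc (Suc (Suc r))) a = 0" for i a
    by (simp_all add: u_def)
  have rec: "T i j (k + 1) * T i j (k - 1) =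
      T i (j + 1) k * T i (j - 1) k + T (i + 1) j k * T (i - 1) j k"
    if "1 \<le> i" "i \<le> r" "1 \<le> j" "j \<le> l" "odd (int i + int j + k)" for i j k
    using T that by (simp add: restricted_T_system_def)
  have T0: "T 0 j k = 1" if "j \<le> l + 1" "even (int j + k)" for j k
    using T that by (simp add: restricted_T_system_def)
  have Tr: "T (r + 1) j k = 1" if "j \<le> l + 1" "even (int (r + 1) + int j + k)" for j k
    using T that unfolding restricted_T_system_def by auto
  have Tb: "T i 0 k = 1" if "i \<le> r + 1" "even (int i + k)" for i k
    using T that by (simp add: restricted_T_system_def)
  have Tl: "T i (l + 1) k = 1" if "i \<le> r + 1" "even (int i + int (l + 1) + k)" for i k
    using T that unfolding restricted_T_system_def by auto
  interpret padded_T_system "l + 1" "r + 1" u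
  proof
    fix i j :: nat and a :: int
    show "u i j a \<noteq> 0" if "i \<le> l + 1" "1 \<le> j" "j \<le> r + 1 + 1"
      using that nonzero[of "j - 1" i "- (2 * a + int i + int (j - 1))"] u_Suc[of "j - 1" i a]
      by simp
    show "u 0 j a = 1" if "1 \<le> j" "j \<le> r + 1 + 1"
      using that Tb[of "j - 1" "- (2 * a + int (j - 1))"] u_Suc[of "j - 1" 0 a] by simp
    show "u (l + 1) j a = 1" if "1 \<le> j" "j \<le> r + 1 + 1"
      using that Tl[of "j - 1" "- (2 * a + int (l + 1) + int (j - 1))"] u_Suc[of "j - 1" "l + 1" a]
      by simp
    show "u i 1 a = 1" if "i \<le> l + 1"
      using that T0[of i "- (2 * a + int i)"] u_Suc[of 0 i a] by simp
    show "u i (r + 1 + 1) a = 1" if "i \<le> l + 1"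
      using that Tr[of i "- (2 * a + int i + int (r + 1))"] u_Suc[of "r + 1" i a] by simp
    show "u i j a * u i j (a + 1) =
        u i (j - 1) (a + 1) * u i (j + 1) a + u (i + 1) j a * u (i - 1) j (a + 1)"
      if i: "1 \<le> i" "i < l + 1" and j: "1 \<le> j" "j \<le> r + 1 + 1"
    proof -
      obtain h where jh: "j = Suc h" "h \<le> r + 1" using j by (cases j) auto
      obtain g where ig: "i = Suc g" "g < l" using i by (cases i) auto
      define k where "k = - (2 * a + int i + int h + 1)"
      have here: "u i j a = T h i (k + 1)" "u i j (a + 1) = T h i (k - 1)"
        "u (i + 1) j a = T h (i + 1) k" "u (i - 1) j (a + 1) = T h (i - 1) k"
        using jh ig by (simp_all add: u_Suc k_def algebra_simps)
      have par: "even (int h + int i + (k + 1))" "even (int h + int i + (k - 1))"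
        "even (int h + int (i + 1) + k)" "even (int h + int (i - 1) + k)"
        "odd (int h + int i + k)"
        using ig by (simp_all add: k_def)
      \<comment> \<open>On the boundary rows one factor of the first product is a padding zero, and
        \<open>hirota\<close> reads 1 = 0 + 1.\<close>
      have one: ?thesis if "u i (j - 1) (a + 1) * u i (j + 1) a = 0" "h = 0 \<or> h = r + 1"
        using that T0 Tr par ig unfolding here by auto
      consider "h = 0" | "h = r + 1" | "1 \<le> h" "h \<le> r" using jh by linarith
      then show ?thesis
      proof cases
        case 1
        then show ?thesis using jh by (intro one) (simp_all add: u_outside)
      next
        case 2
        then show ?thesis using jh by (intro one) (simp_all add: u_outside)
      next
        case 3
        then obtain f where f: "h = Suc f" by (cases h) auto
        have "u i (j - 1) (a + 1) = T (h - 1) i k" "u i (j + 1) a = T (h + 1) i k"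
          using jh 3 f by (simp_all add: u_Suc k_def algebra_simps)
        moreover have "T h i (k + 1) * T h i (k - 1) =
            T h (i + 1) k * T h (i - 1) k + T (h + 1) i k * T (h - 1) i k"
          using i 3 par by (intro rec) auto
        ultimately show ?thesis unfolding here by (simp add: mult.commute add.commute)
      qed
    qed
  qed (use \<open>1 \<le> r\<close> in \<open>auto simp: u_outside\<close>)
  obtain b where "int j + k + int l + int r + 1 = 2 * b" using par by (elim evenE)
  then have k: "k = 2 * b - int j - int l - int r - 1" by simp
  \<comment> \<open>The value \<open>a = - b - 1\<close> makes the two times equal to
    \<open>k + l + r + 2\<close> and \<open>k\<close>.\<close>
  have "u j 2 (- b - 1) = u (l + 1 - j) (r + 1) (- b - 1 + int j + 1)"
    by (rule half_periodicity[OF j])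
  moreover have "u j 2 (- b - 1) = T 1 j (k + int (l + r + 2))"
    using u_Suc[of 1 j "- b - 1"] by (simp add: k numeral_2_eq_2 algebra_simps)
  moreover have "u (l + 1 - j) (r + 1) (- b - 1 + int j + 1) = T r (l + 1 - j) k"
    using j u_Suc[of r "l + 1 - j" "- b - 1 + int j + 1"] by (simp add: k of_nat_diff algebra_simps)
  ultimately show ?thesis by simp
qed

section \<open>Positivity, hence nonvanishing, of the solution\<close>

definition nonneg_poly :: "('a::monoid_add \<Rightarrow>\<^sub>0 'b::linordered_idom) \<Rightarrow> bool" where
  "nonneg_poly p \<longleftrightarrow> (\<forall>x. 0 \<le> Poly_Mapping.lookup p x)"

lemma nonneg_poly_mult:
  assumes "nonneg_poly p" "nonneg_poly q"
  shows "nonneg_poly (p * q)"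
  using assms
  by (auto simp: nonneg_poly_def lookup_mult when_def Sum_any.expand_set
      intro!: sum_nonneg mult_nonneg_nonneg)

lemma nonneg_poly_add:
  "nonneg_poly p \<Longrightarrow> nonneg_poly q \<Longrightarrow> nonneg_poly (p + q)"
  by (simp add: nonneg_poly_def lookup_add)

text \<open>Nonnegative coefficients cannot cancel; this keeps the numerator of a sum of
  subtraction-free fractions nonzero.\<close>

lemma nonneg_poly_add_eq_0:
  assumes "nonneg_poly p" "nonneg_poly q" "p + q = 0"
  shows "p = 0"
proof (rule poly_mapping_eqI)
  fix x
  have "Poly_Mapping.lookup p x + Poly_Mapping.lookup q x = 0" using assms(3) by (metis lookup_add lookup_zero)
  with assms(1,2) show "Poly_Mapping.lookup p x = Poly_Mapping.lookup 0 x"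
    by (simp add: nonneg_poly_def add_nonneg_eq_0_iff)
qed

text \<open>Excluding a zero numerator gives closure under inverses and makes every such fraction
  nonzero.\<close>

definition subtraction_free :: "tratfun \<Rightarrow> bool" where
  "subtraction_free f \<longleftrightarrow>
     (\<exists>p q. f = Fract p q \<and> p \<noteq> 0 \<and> q \<noteq> 0 \<and> nonneg_poly p \<and> nonneg_poly q)"

lemma subtraction_free_nonzero: "subtraction_free f \<Longrightarrow> f \<noteq> 0"
  by (auto simp: subtraction_free_def Zero_fract_def eq_fract)

lemma subtraction_free_1: "subtraction_free 1"
  unfolding subtraction_free_def
  by (rule exI[of _ 1], rule exI[of _ 1])
    (auto simp: One_fract_def nonneg_poly_def lookup_one when_def)

lemma subtraction_free_tvar: "subtraction_free (tvar i j)"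
proof -
  let ?p = "Poly_Mapping.single (Poly_Mapping.single (i, j) 1) 1 :: tpoly"
  have "?p \<noteq> 0" by (metis lookup_single_eq lookup_zero zero_neq_one)
  moreover have "nonneg_poly ?p" "nonneg_poly (1 :: tpoly)"
    by (simp_all add: nonneg_poly_def lookup_one lookup_single when_def)
  ultimately show ?thesis
    unfolding subtraction_free_def tvar_def to_fract_def by (metis one_neq_zero)
qed

lemma subtraction_free_add:
  assumes "subtraction_free f" "subtraction_free g"
  shows "subtraction_free (f + g)"
proof -
  obtain p q p' q' where f: "f = Fract p q" "p \<noteq> 0" "q \<noteq> 0" "nonneg_poly p" "nonneg_poly q"
    and g: "g = Fract p' q'" "p' \<noteq> 0" "q' \<noteq> 0" "nonneg_poly p'" "nonneg_poly q'"
    using assms by (auto simp: subtraction_free_def)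
  have "p * q' + p' * q \<noteq> 0"
    using nonneg_poly_add_eq_0[of "p * q'" "p' * q"] f g by (auto simp: nonneg_poly_mult)
  then show ?thesis using f g unfolding subtraction_free_def
    by (intro exI[of _ "p * q' + p' * q"] exI[of _ "q * q'"])
      (auto simp: nonneg_poly_mult nonneg_poly_add)
qed

lemma subtraction_free_mult:
  assumes "subtraction_free f" "subtraction_free g"
  shows "subtraction_free (f * g)"
proof -
  obtain p q p' q' where f: "f = Fract p q" "p \<noteq> 0" "q \<noteq> 0" "nonneg_poly p" "nonneg_poly q"
    and g: "g = Fract p' q'" "p' \<noteq> 0" "q' \<noteq> 0" "nonneg_poly p'" "nonneg_poly q'"
    using assms by (auto simp: subtraction_free_def)
  then show ?thesis unfolding subtraction_free_def
    by (intro exI[of _ "p * p'"] exI[of _ "q * q'"]) (auto simp: nonneg_poly_mult)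
qed

lemma subtraction_free_inverse:
  "subtraction_free f \<Longrightarrow> subtraction_free (inverse f)"
  unfolding subtraction_free_def by (metis inverse_fract)

lemma subtraction_free_cancel:
  assumes "subtraction_free f" "subtraction_free (f * g)"
  shows "subtraction_free g"
proof -
  have "inverse f * (f * g) = g" using subtraction_free_nonzero[OF assms(1)] by simp
  then show ?thesis using subtraction_free_mult[OF subtraction_free_inverse[OF assms(1)] assms(2)]
    by metis
qed

text \<open>Starting from the layers \<open>k = 0\<close> and \<open>k = 1\<close>, the recursion
  yields each further layer, forwards and backwards in time, by sums, products and one division by a
  value already known to be subtraction-free.\<close>

lemma restricted_T_system_subtraction_free:
  assumes T: "restricted_T_system r l T" and init: "has_initial_values r l tvar T"
    and "i \<le> r + 1" "j \<le> l + 1" "even (int i + int j + k)"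
  shows "subtraction_free (T i j k)"
proof -
  define Q where "Q k \<longleftrightarrow> (\<forall>i j. i \<le> r + 1 \<longrightarrow> j \<le> l + 1 \<longrightarrow> even (int i + int j + k) \<longrightarrow>
    subtraction_free (T i j k))" for k
  have boundary: "T i j k = 1"
    if "i \<le> r + 1" "j \<le> l + 1" "even (int i + int j + k)" "\<not> (i \<in> {1..r} \<and> j \<in> {1..l})" for i j k
  proof -
    have "i = 0 \<or> i = r + 1 \<or> j = 0 \<or> j = l + 1" using that by auto
    moreover have "T 0 j k = 1" if "j \<in> {0..l + 1}" "even (int j + k)" for j k
      using T that unfolding restricted_T_system_def by blast
    moreover have "T (r + 1) j k = 1" if "j \<in> {0..l + 1}" "even (int (r + 1) + int j + k)" for j k
      using T that unfolding restricted_T_system_def by blast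
    moreover have "T i 0 k = 1" if "i \<in> {0..r + 1}" "even (int i + k)" for i k
      using T that unfolding restricted_T_system_def by blast
    moreover have "T i (l + 1) k = 1" if "i \<in> {0..r + 1}" "even (int i + int (l + 1) + k)" for i k
      using T that unfolding restricted_T_system_def by blast
    ultimately show ?thesis using that(1-3) by (elim disjE) simp_all
  qed
  have QI: "Q k" if "\<And>i j. i \<in> {1..r} \<Longrightarrow> j \<in> {1..l} \<Longrightarrow> even (int i + int j + k) \<Longrightarrow>
    subtraction_free (T i j k)" for k
    unfolding Q_def using that boundary subtraction_free_1 by metis
  have prod: "subtraction_free (T i j (k + 1) * T i j (k - 1))"
    if "Q k" "i \<in> {1..r}" "j \<in> {1..l}" "odd (int i + int j + k)" for i j k
  proof -
    have eq: "T i j (k + 1) * T i j (k - 1) =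
        T i (j + 1) k * T i (j - 1) k + T (i + 1) j k * T (i - 1) j k"
      using T that unfolding restricted_T_system_def by blast
    have "subtraction_free (T i (j + 1) k)" "subtraction_free (T i (j - 1) k)"
      "subtraction_free (T (i + 1) j k)" "subtraction_free (T (i - 1) j k)"
      by (rule that(1)[unfolded Q_def, rule_format]; use that(2-4) in auto)+
    then show ?thesis unfolding eq by (intro subtraction_free_add subtraction_free_mult)
  qed
  have up: "Q (k + 1)" if "Q k" "Q (k - 1)" for k
  proof (rule QI)
    fix i j assume ij: "i \<in> {1..r}" "j \<in> {1..l}" "even (int i + int j + (k + 1))"
    then have "subtraction_free (T i j (k - 1))" using that(2) unfolding Q_def by auto
    moreover have "subtraction_free (T i j (k - 1) * T i j (k + 1))"
      using prod[OF that(1) ij(1,2)] ij(3) by (auto simp: mult.commute)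
    ultimately show "subtraction_free (T i j (k + 1))" by (rule subtraction_free_cancel)
  qed
  have down: "Q (k - 1)" if "Q k" "Q (k + 1)" for k
  proof (rule QI)
    fix i j assume ij: "i \<in> {1..r}" "j \<in> {1..l}" "even (int i + int j + (k - 1))"
    then have "subtraction_free (T i j (k + 1))" using that(2) unfolding Q_def by auto
    moreover have "subtraction_free (T i j (k + 1) * T i j (k - 1))"
      using prod[OF that(1) ij(1,2)] ij(3) by auto
    ultimately show "subtraction_free (T i j (k - 1))" by (rule subtraction_free_cancel)
  qed
  have start: "Q k" if "k = 0 \<or> k = 1" for k
  proof (rule QI)
    fix i j assume ij: "i \<in> {1..r}" "j \<in> {1..l}" "even (int i + int j + k)"
    \<comment> \<open>The parity condition decides which of the two starting layers holds the
      variable at \<open>(i, j)\<close>.\<close>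
    then have "initial_time i j = k" using that unfolding initial_time_def by presburger
    then have "T i j k = tvar i j" using init ij unfolding has_initial_values_def by auto
    then show "subtraction_free (T i j k)" by (simp add: subtraction_free_tvar)
  qed
  \<comment> \<open>The recursion has order two in time, so two adjacent layers are carried
    along.\<close>
  have "Q k \<and> Q (k + 1)"
  proof (induction k rule: int_induct[of _ 0])
    case base
    then show ?case by (simp add: start)
  next
    case (step1 k)
    then show ?case using up[of "k + 1"] by simp
  next
    case (step2 k)
    then show ?case using down[of k] by simp
  qed
  then show ?thesis using assms(3-5) unfolding Q_def by blast
qed

theorem theorem5p24:
  fixes r l N :: nat and T :: "nat \<Rightarrow> nat \<Rightarrow> int \<Rightarrow> tratfun"
  assumes "r \<ge> 1" and "l \<ge> 1" and "N = 2 * (l + r + 2)"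
    and "restricted_T_system r l T"
    and "has_initial_values r l tvar T"
  shows "\<forall>k::int. \<forall>j\<in>{1..l}. odd (int j + k + int l + int r) \<longrightarrow>
           T 1 j (k + int (N div 2)) = T r (l + 1 - j) k"
proof (intro allI ballI impI)
  fix k :: int and j assume "j \<in> {1..l}" "odd (int j + k + int l + int r)"
  moreover have "N div 2 = l + r + 2" using assms(3) by simp
  ultimately show "T 1 j (k + int (N div 2)) = T r (l + 1 - j) k"
    using restricted_T_system_half_periodicity[OF assms(4,1), of j k]
      restricted_T_system_subtraction_free[OF assms(4,5)] subtraction_free_nonzero
    by auto
qed

end
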